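(* Let $F:\mathcal{A}\to\mathcal{C}$ be a form such that $f.A$ and $B.f$ exist for every $\mathcal{C}$-morphism $f:X\to Y$, $A\in F^{-1}X$, $B\in F^{-1}Y$. Then $\mathrm{MTORD}(F)$ and $\mathrm{JTORD}(F)$ are each closed under arbitrary intersections in $\mathrm{TORD}(F)$, and are thus reflective subcategories of $\mathrm{TORD}(F)$ (regarded as a category via the partial order $\subseteq$); that is, for every $\sqsubset\in\mathrm{TORD}(F)$ there is a least element of $\mathrm{MTORD}(F)$ (respectively of $\mathrm{JTORD}(F)$) containing $\sqsubset$.
   Context: A form over a category $\mathcal{C}$ is a functor $F:\mathcal{A}\to\mathcal{C}$ that is faithful and amnestic (an isomorphism $h:A\to B$ in $\mathcal{A}$ with $Fh=1_{FA}$ satisfies $A=B$, $h=1_A$). The fibre $F^{-1}X$ consists of the objects $A$ with $FA=X$. For $f:X\to Y$ in $\mathcal{C}$, $A\in F^{-1}X$, $B\in F^{-1}Y$, write $A\leq_f B$ if there is an $\mathcal{A}$-morphism $\alpha:A\to B$ with $F\alpha=f$; $\leq_X$ means $\leq_{1_X}$, a partial order on $F^{-1}X$. The object $f.A\in F^{-1}Y$ is the codomain of a cocartesian lifting of $f$ at $A$: $A\leq_f f.A$, and for all $C\in\mathcal{A}$ and $g:Y\to FC$, $f.A\leq_g C\Leftrightarrow A\leq_{g\circ f}C$. Dually, $B.f\in F^{-1}X$ is the domain of a cartesian lifting of $f$ at $B$: $B.f\leq_f B$, and for all $C\in\mathcal{A}$ and $g:FC\to X$, $C\leq_g B.f\Leftrightarrow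 C\leq_{f\circ g}B$. A topogenous order $\sqsubset$ on $F$ is a family of binary relations $\sqsubset_X$ on $F^{-1}X$ ($X\in\mathcal{C}$) with (T1) $A\sqsubset_X B\Rightarrow A\leq_X B$; (T2) $A'\leq_X A\sqsubset_X B\leq_X B'\Rightarrow A'\sqsubset_X B'$; (T3) for every $f:X\to Y$ in $\mathcal{C}$, $A\in F^{-1}X$, $B\in F^{-1}Y$: $f.A\sqsubset_Y B\Rightarrow A\sqsubset_X B.f$. $\mathrm{TORD}(F)$ is the collection of all topogenous orders on $F$, ordered by $\sqsubset\subseteq\sqsubset'$ iff $A\sqsubset_X B\Rightarrow A\sqsubset'_X B$ for all $X,A,B$. Intersections are formed relation by relation in each fibre; the empty intersection in $\mathrm{TORD}(F)$ is its largest element $\{\leq_X\}_{X\in\mathcal{C}}$. Condition $(TM)$: for every family $(B_i)_{i\in I}$ in $F^{-1}X$ whose meet exists, if $A\sqsubset_X B_i$ for all $i\in I$ then $A\sqsubset_X\bigwedge B_i$. Condition $(TJ)$: for every family $(A_i)_{i\in I}$ in $F^{-1}X$ whose join exists, if $A_i\sqsubset_X B$ for all $i\in I$ then $\bigvee A_i\sqsubset_X B$. $\mathrm{MTORD}(F)$ (resp. $\mathrm{JTORD}(F)$) is the collection of topogenous orders on $F$ satisfying $(TM)$ (resp. $(TJ)$). *)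

theory Defs
  imports "HOL-Algebra.Order"
begin

section \<open>Categories and reflective subcategories\<close>

record ('o, 'm) cat =
  Ob :: "'o set"
  Ar :: "'m set"
  Dom :: "'m \<Rightarrow> 'o"
  Cod :: "'m \<Rightarrow> 'o"
  Ident :: "'o \<Rightarrow> 'm"
  Comp :: "'m \<Rightarrow> 'm \<Rightarrow> 'm"

text \<open>\<^term>\<open>Comp C g f\<close> is the composite "g after f".\<close>

definition Hom :: "('o, 'm) cat \<Rightarrow> 'o \<Rightarrow> 'o \<Rightarrow> 'm set" where
  "Hom C X Y = {f \<in> Ar C. Dom C f = X \<and> Cod C f = Y}"

definition category :: "('o, 'm) cat \<Rightarrow> bool" where
  "category C \<longleftrightarrow>
     (\<forall>f\<in>Ar C. Dom C f \<in> Ob C \<and> Cod C f \<in> Ob C) \<and>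
     (\<forall>X\<in>Ob C. Ident C X \<in> Hom C X X) \<and>
     (\<forall>f\<in>Ar C. \<forall>g\<in>Ar C. Dom C g = Cod C f \<longrightarrow> Comp C g f \<in> Hom C (Dom C f) (Cod C g)) \<and>
     (\<forall>f\<in>Ar C. Comp C f (Ident C (Dom C f)) = f \<and> Comp C (Ident C (Cod C f)) f = f) \<and>
     (\<forall>f\<in>Ar C. \<forall>g\<in>Ar C. \<forall>h\<in>Ar C. Dom C g = Cod C f \<longrightarrow> Dom C h = Cod C g \<longrightarrow>
        Comp C h (Comp C g f) = Comp C (Comp C h g) f)"

definition is_iso :: "('o, 'm) cat \<Rightarrow> 'm \<Rightarrow> bool" where
  "is_iso C h \<longleftrightarrow> h \<in> Ar C \<and>
     (\<exists>k\<in>Hom C (Cod C h) (Dom C h).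
        Comp C k h = Ident C (Dom C h) \<and> Comp C h k = Ident C (Cod C h))"

definition subcategory :: "('o, 'm) cat \<Rightarrow> ('o, 'm) cat \<Rightarrow> bool" where
  "subcategory B C \<longleftrightarrow> category B \<and> category C \<and> Ob B \<subseteq> Ob C \<and>
     (\<forall>X\<in>Ob B. \<forall>Y\<in>Ob B. Hom B X Y \<subseteq> Hom C X Y) \<and>
     (\<forall>X\<in>Ob B. Ident B X = Ident C X) \<and>
     (\<forall>f\<in>Ar B. \<forall>g\<in>Ar B. Dom B g = Cod B f \<longrightarrow> Comp B g f = Comp C g f)"

definition reflective_subcategory :: "('o, 'm) cat \<Rightarrow> ('o, 'm) cat \<Rightarrow> bool" where
  "reflective_subcategory B C \<longleftrightarrow> subcategory B C \<and>
     (\<forall>X\<in>Ob C. \<exists>A\<in>Ob B. \<exists>r\<in>Hom C X A.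
        \<forall>A'\<in>Ob B. \<forall>f\<in>Hom C X A'. \<exists>!g. g \<in> Hom B A A' \<and> Comp C g r = f)"

text \<open>A (partially) ordered set regarded as a category.\<close>

definition order_category :: "('a, 'b) gorder_scheme \<Rightarrow> ('a, 'a \<times> 'a) cat" where
  "order_category L =
     \<lparr>Ob = carrier L,
      Ar = {(x, y). x \<in> carrier L \<and> y \<in> carrier L \<and> x \<sqsubseteq>\<^bsub>L\<^esub> y},
      Dom = fst,
      Cod = snd,
      Ident = (\<lambda>x. (x, x)),
      Comp = (\<lambda>g f. (fst f, snd g))\<rparr>"

section \<open>Forms\<close>

record ('a, 'm, 'c, 'n) fctr =
  Src :: "('a, 'm) cat"
  Tgt :: "('c, 'n) cat"
  FOb :: "'a \<Rightarrow> 'c"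
  FAr :: "'m \<Rightarrow> 'n"

definition is_functor :: "('a, 'm, 'c, 'n) fctr \<Rightarrow> bool" where
  "is_functor F \<longleftrightarrow> category (Src F) \<and> category (Tgt F) \<and>
     (\<forall>A\<in>Ob (Src F). FOb F A \<in> Ob (Tgt F)) \<and>
     (\<forall>\<alpha>\<in>Ar (Src F). FAr F \<alpha> \<in> Hom (Tgt F) (FOb F (Dom (Src F) \<alpha>)) (FOb F (Cod (Src F) \<alpha>))) \<and>
     (\<forall>A\<in>Ob (Src F). FAr F (Ident (Src F) A) = Ident (Tgt F) (FOb F A)) \<and>
     (\<forall>\<alpha>\<in>Ar (Src F). \<forall>\<beta>\<in>Ar (Src F). Dom (Src F) \<beta> = Cod (Src F) \<alpha> \<longrightarrow>
        FAr F (Comp (Src F) \<beta> \<alpha>) = Comp (Tgt F) (FAr F \<beta>) (FAr F \<alpha>))"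

definition faithful :: "('a, 'm, 'c, 'n) fctr \<Rightarrow> bool" where
  "faithful F \<longleftrightarrow>
     (\<forall>A\<in>Ob (Src F). \<forall>B\<in>Ob (Src F). inj_on (FAr F) (Hom (Src F) A B))"

definition amnestic :: "('a, 'm, 'c, 'n) fctr \<Rightarrow> bool" where
  "amnestic F \<longleftrightarrow>
     (\<forall>A\<in>Ob (Src F). \<forall>B\<in>Ob (Src F). \<forall>h\<in>Hom (Src F) A B.
        is_iso (Src F) h \<longrightarrow> FAr F h = Ident (Tgt F) (FOb F A) \<longrightarrow>
        A = B \<and> h = Ident (Src F) A)"

definition form :: "('a, 'm, 'c, 'n) fctr \<Rightarrow> bool" where
  "form F \<longleftrightarrow> is_functor F \<and> faithful F \<and> amnestic F"

definition fibre :: "('a, 'm, 'c, 'n) fctr \<Rightarrow> 'c \<Rightarrow> 'a set" where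
  "fibre F X = {A \<in> Ob (Src F). FOb F A = X}"

definition le_over :: "('a, 'm, 'c, 'n) fctr \<Rightarrow> 'n \<Rightarrow> 'a \<Rightarrow> 'a \<Rightarrow> bool" where
  "le_over F f A B \<longleftrightarrow> (\<exists>\<alpha>\<in>Hom (Src F) A B. FAr F \<alpha> = f)"

definition fibre_order :: "('a, 'm, 'c, 'n) fctr \<Rightarrow> 'c \<Rightarrow> 'a gorder" where
  "fibre_order F X =
     \<lparr>carrier = fibre F X, eq = (=), le = le_over F (Ident (Tgt F) X)\<rparr>"

section \<open>Cocartesian and cartesian liftings\<close>

definition is_push :: "('a, 'm, 'c, 'n) fctr \<Rightarrow> 'n \<Rightarrow> 'a \<Rightarrow> 'a \<Rightarrow> bool" where
  "is_push F f A D \<longleftrightarrow> D \<in> fibre F (Cod (Tgt F) f) \<and> le_over F f A D \<and>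
     (\<forall>C\<in>Ob (Src F). \<forall>g\<in>Hom (Tgt F) (Cod (Tgt F) f) (FOb F C).
        le_over F g D C \<longleftrightarrow> le_over F (Comp (Tgt F) g f) A C)"

definition is_pull :: "('a, 'm, 'c, 'n) fctr \<Rightarrow> 'n \<Rightarrow> 'a \<Rightarrow> 'a \<Rightarrow> bool" where
  "is_pull F f B D \<longleftrightarrow> D \<in> fibre F (Dom (Tgt F) f) \<and> le_over F f D B \<and>
     (\<forall>C\<in>Ob (Src F). \<forall>g\<in>Hom (Tgt F) (FOb F C) (Dom (Tgt F) f).
        le_over F g C D \<longleftrightarrow> le_over F (Comp (Tgt F) f g) C B)"

text \<open>\<^term>\<open>push F f A\<close> is \<open>f.A\<close> and \<^term>\<open>pull F f B\<close> is \<open>B.f\<close>.  They are meaningful only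
  when they exist; uniqueness is proved below.\<close>

definition push :: "('a, 'm, 'c, 'n) fctr \<Rightarrow> 'n \<Rightarrow> 'a \<Rightarrow> 'a" where
  "push F f A = (THE D. is_push F f A D)"

definition pull :: "('a, 'm, 'c, 'n) fctr \<Rightarrow> 'n \<Rightarrow> 'a \<Rightarrow> 'a" where
  "pull F f B = (THE D. is_pull F f B D)"

definition has_liftings :: "('a, 'm, 'c, 'n) fctr \<Rightarrow> bool" where
  "has_liftings F \<longleftrightarrow> (\<forall>f\<in>Ar (Tgt F).
     (\<forall>A\<in>fibre F (Dom (Tgt F) f). \<exists>D. is_push F f A D) \<and>
     (\<forall>B\<in>fibre F (Cod (Tgt F) f). \<exists>D. is_pull F f B D))"

lemma categoryD:
  assumes "category C"
  shows "f \<in> Ar C \<Longrightarrow> Dom C f \<in> Ob C" "f \<in> Ar C \<Longrightarrow> Cod C f \<in> Ob C"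
    "X \<in> Ob C \<Longrightarrow> Ident C X \<in> Hom C X X"
    "f \<in> Hom C X Y \<Longrightarrow> g \<in> Hom C Y Z \<Longrightarrow> Comp C g f \<in> Hom C X Z"
    "f \<in> Hom C X Y \<Longrightarrow> Comp C f (Ident C X) = f"
    "f \<in> Hom C X Y \<Longrightarrow> Comp C (Ident C Y) f = f"
  using assms unfolding category_def by (simp_all add: Hom_def) blast+

lemma functorD:
  assumes "is_functor F"
  shows "category (Src F)" "category (Tgt F)"
    "A \<in> Ob (Src F) \<Longrightarrow> FAr F (Ident (Src F) A) = Ident (Tgt F) (FOb F A)"
    "\<alpha> \<in> Hom (Src F) A B \<Longrightarrow> \<beta> \<in> Hom (Src F) B D \<Longrightarrow>
       FAr F (Comp (Src F) \<beta> \<alpha>) = Comp (Tgt F) (FAr F \<beta>) (FAr F \<alpha>)"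
  using assms unfolding is_functor_def by (simp_all add: Hom_def)

lemma partial_order_fibre_order:
  assumes F: "form F" and X: "X \<in> Ob (Tgt F)"
  shows "partial_order (fibre_order F X)"
proof -
  let ?A = "Src F" and ?C = "Tgt F"
  have fF: "is_functor F" and faith: "faithful F" and amn: "amnestic F"
    using F by (auto simp: form_def)
  note D = functorD[OF fF]
  note cA = categoryD[OF D(1)] and cC = categoryD[OF D(2)]
  have II: "Comp ?C (Ident ?C X) (Ident ?C X) = Ident ?C X"
    by (rule cC(5)[OF cC(3)[OF X]])
  have refl: "le_over F (Ident ?C X) A A" if "A \<in> fibre F X" for A
    using that cA(3)[of A] D(3)[of A] by (auto simp: le_over_def fibre_def)
  have comp: "Comp ?A \<beta> \<alpha> \<in> Hom ?A A E" "FAr F (Comp ?A \<beta> \<alpha>) = Ident ?C X"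
    if "\<alpha> \<in> Hom ?A A B" "FAr F \<alpha> = Ident ?C X" "\<beta> \<in> Hom ?A B E" "FAr F \<beta> = Ident ?C X"
    for \<alpha> \<beta> A B E
    using cA(4)[OF that(1,3)] D(4)[OF that(1,3)] that(2,4) II by simp_all
  have trans: "le_over F (Ident ?C X) A E"
    if "le_over F (Ident ?C X) A B" "le_over F (Ident ?C X) B E" for A B E
    using that comp unfolding le_over_def by blast
  have anti: "A = B"
    if A: "A \<in> fibre F X" and B: "B \<in> fibre F X"
      and le: "le_over F (Ident ?C X) A B" "le_over F (Ident ?C X) B A" for A B
  proof -
    obtain \<alpha> where a: "\<alpha> \<in> Hom ?A A B" "FAr F \<alpha> = Ident ?C X"
      using le(1) unfolding le_over_def by blast
    obtain \<beta> where b: "\<beta> \<in> Hom ?A B A" "FAr F \<beta> = Ident ?C X"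
      using le(2) unfolding le_over_def by blast
    have inv: "Comp ?A v u = Ident ?A P"
      if P: "P \<in> fibre F X" and u: "u \<in> Hom ?A P Q" "FAr F u = Ident ?C X"
        and v: "v \<in> Hom ?A Q P" "FAr F v = Ident ?C X" for P Q u v
    proof -
      have P': "P \<in> Ob ?A" "FOb F P = X" using P by (auto simp: fibre_def)
      have "inj_on (FAr F) (Hom ?A P P)"
        using faith P' unfolding faithful_def by blast
      then show ?thesis
        using comp[OF u v] D(3)[OF P'(1)] cA(3)[OF P'(1)] P'(2) by (simp add: inj_on_def)
    qed
    have "is_iso ?A \<alpha>"
      using inv[OF A a b] inv[OF B b a] a(1) b(1) by (auto simp: is_iso_def Hom_def)
    then show "A = B"
      using amn A B a by (auto simp: amnestic_def fibre_def)
  qed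
  show ?thesis
  proof
    fix A B E
    show "A \<sqsubseteq>\<^bsub>fibre_order F X\<^esub> A" if "A \<in> carrier (fibre_order F X)"
      using that refl by (simp add: fibre_order_def)
    show "A .=\<^bsub>fibre_order F X\<^esub> B" if "A \<sqsubseteq>\<^bsub>fibre_order F X\<^esub> B" "B \<sqsubseteq>\<^bsub>fibre_order F X\<^esub> A"
      "A \<in> carrier (fibre_order F X)" "B \<in> carrier (fibre_order F X)"
      using that anti by (simp add: fibre_order_def)
    show "A \<sqsubseteq>\<^bsub>fibre_order F X\<^esub> E" if "A \<sqsubseteq>\<^bsub>fibre_order F X\<^esub> B" "B \<sqsubseteq>\<^bsub>fibre_order F X\<^esub> E"
      using that trans[of A B E] by (simp add: fibre_order_def)
  qed (auto simp: fibre_order_def)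
qed

lemma push_unique:
  assumes F: "form F" and f: "f \<in> Ar (Tgt F)" and p: "is_push F f A D" "is_push F f A D'"
  shows "D = D'"
proof -
  let ?Y = "Cod (Tgt F) f" and ?I = "Ident (Tgt F) (Cod (Tgt F) f)"
  have C: "category (Tgt F)" using F by (simp add: form_def is_functor_def)
  note c = categoryD[OF C]
  have id: "?I \<in> Hom (Tgt F) ?Y ?Y" "Comp (Tgt F) ?I f = f"
    using c(2)[OF f] c(3) c(6)[of f "Dom (Tgt F) f" ?Y] f by (simp_all add: Hom_def)
  interpret partial_order "fibre_order F ?Y"
    by (rule partial_order_fibre_order[OF F c(2)[OF f]])
  have "le_over F ?I D D'" "le_over F ?I D' D"
    using p id by (auto simp: is_push_def fibre_def)
  then show ?thesis
    using p le_antisym[of D D'] by (simp add: is_push_def fibre_order_def)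
qed

lemma pull_unique:
  assumes F: "form F" and f: "f \<in> Ar (Tgt F)" and p: "is_pull F f B D" "is_pull F f B D'"
  shows "D = D'"
proof -
  let ?X = "Dom (Tgt F) f" and ?I = "Ident (Tgt F) (Dom (Tgt F) f)"
  have C: "category (Tgt F)" using F by (simp add: form_def is_functor_def)
  note c = categoryD[OF C]
  have id: "?I \<in> Hom (Tgt F) ?X ?X" "Comp (Tgt F) f ?I = f"
    using c(1)[OF f] c(3) c(5)[of f ?X "Cod (Tgt F) f"] f by (simp_all add: Hom_def)
  interpret partial_order "fibre_order F ?X"
    by (rule partial_order_fibre_order[OF F c(1)[OF f]])
  have "le_over F ?I D D'" "le_over F ?I D' D"
    using p id by (auto simp: is_pull_def fibre_def)
  then show ?thesis
    using p le_antisym[of D D'] by (simp add: is_pull_def fibre_order_def)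
qed

section \<open>Topogenous orders\<close>

text \<open>A family of relations on the fibres is a function into \<^typ>\<open>'a rel\<close>; since
  \<^term>\<open>fibre F X\<close> is empty for \<open>X\<close> outside \<^term>\<open>Ob (Tgt F)\<close>, the first conjunct
  below leaves no freedom there, so equality of functions is equality of families.\<close>

definition TORD :: "('a, 'm, 'c, 'n) fctr \<Rightarrow> ('c \<Rightarrow> 'a rel) set" where
  "TORD F = {R.
     (\<forall>X. R X \<subseteq> fibre F X \<times> fibre F X) \<and>
     (\<forall>X\<in>Ob (Tgt F). \<forall>A B. (A, B) \<in> R X \<longrightarrow> A \<sqsubseteq>\<^bsub>fibre_order F X\<^esub> B) \<and>
     (\<forall>X\<in>Ob (Tgt F). \<forall>A'\<in>fibre F X. \<forall>A\<in>fibre F X. \<forall>B\<in>fibre F X. \<forall>B'\<in>fibre F X.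
        A' \<sqsubseteq>\<^bsub>fibre_order F X\<^esub> A \<longrightarrow> (A, B) \<in> R X \<longrightarrow> B \<sqsubseteq>\<^bsub>fibre_order F X\<^esub> B' \<longrightarrow>
        (A', B') \<in> R X) \<and>
     (\<forall>f\<in>Ar (Tgt F). \<forall>A\<in>fibre F (Dom (Tgt F) f). \<forall>B\<in>fibre F (Cod (Tgt F) f).
        (push F f A, B) \<in> R (Cod (Tgt F) f) \<longrightarrow> (A, pull F f B) \<in> R (Dom (Tgt F) f))}"

definition TORD_order :: "('a, 'm, 'c, 'n) fctr \<Rightarrow> ('c \<Rightarrow> 'a rel) gorder" where
  "TORD_order F =
     \<lparr>carrier = TORD F, eq = (=), le = (\<lambda>R S. \<forall>X\<in>Ob (Tgt F). R X \<subseteq> S X)\<rparr>"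

definition TORD_top :: "('a, 'm, 'c, 'n) fctr \<Rightarrow> 'c \<Rightarrow> 'a rel" where
  "TORD_top F X = {(A, B). A \<in> fibre F X \<and> B \<in> fibre F X \<and> A \<sqsubseteq>\<^bsub>fibre_order F X\<^esub> B}"

definition TORD_Inter :: "('a, 'm, 'c, 'n) fctr \<Rightarrow> ('c \<Rightarrow> 'a rel) set \<Rightarrow> 'c \<Rightarrow> 'a rel" where
  "TORD_Inter F \<K> = (if \<K> = {} then TORD_top F else (\<lambda>X. \<Inter>R\<in>\<K>. R X))"

text \<open>A meet or join of a family depends only on its set of members, so the conditions are
  stated for subsets of the fibre; the version for families over an arbitrary index type
  follows.  The empty family is included.\<close>

definition TM :: "('a, 'm, 'c, 'n) fctr \<Rightarrow> ('c \<Rightarrow> 'a rel) \<Rightarrow> bool" where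
  "TM F R \<longleftrightarrow> (\<forall>X\<in>Ob (Tgt F). \<forall>A\<in>fibre F X. \<forall>\<B> M.
     \<B> \<subseteq> fibre F X \<longrightarrow> is_glb (fibre_order F X) M \<B> \<longrightarrow>
     (\<forall>B\<in>\<B>. (A, B) \<in> R X) \<longrightarrow> (A, M) \<in> R X)"

definition TJ :: "('a, 'm, 'c, 'n) fctr \<Rightarrow> ('c \<Rightarrow> 'a rel) \<Rightarrow> bool" where
  "TJ F R \<longleftrightarrow> (\<forall>X\<in>Ob (Tgt F). \<forall>B\<in>fibre F X. \<forall>\<A> J.
     \<A> \<subseteq> fibre F X \<longrightarrow> is_lub (fibre_order F X) J \<A> \<longrightarrow>
     (\<forall>A\<in>\<A>. (A, B) \<in> R X) \<longrightarrow> (J, B) \<in> R X)"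

lemma TM_family:
  assumes "TM F R" "X \<in> Ob (Tgt F)" "A \<in> fibre F X"
    and "\<And>i. i \<in> I \<Longrightarrow> B i \<in> fibre F X" "is_glb (fibre_order F X) M (B ` I)"
    and "\<And>i. i \<in> I \<Longrightarrow> (A, B i) \<in> R X"
  shows "(A, M) \<in> R X"
proof -
  have "B ` I \<subseteq> fibre F X" "\<forall>b\<in>B ` I. (A, b) \<in> R X" using assms(4,6) by auto
  with assms(1)[unfolded TM_def, rule_format, OF assms(2,3) _ assms(5)] show ?thesis by blast
qed

lemma TJ_family:
  assumes "TJ F R" "X \<in> Ob (Tgt F)" "B \<in> fibre F X"
    and "\<And>i. i \<in> I \<Longrightarrow> A i \<in> fibre F X" "is_lub (fibre_order F X) J (A ` I)"
    and "\<And>i. i \<in> I \<Longrightarrow> (A i, B) \<in> R X"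
  shows "(J, B) \<in> R X"
proof -
  have "A ` I \<subseteq> fibre F X" "\<forall>a\<in>A ` I. (a, B) \<in> R X" using assms(4,6) by auto
  with assms(1)[unfolded TJ_def, rule_format, OF assms(2,3) _ assms(5)] show ?thesis by blast
qed

definition MTORD :: "('a, 'm, 'c, 'n) fctr \<Rightarrow> ('c \<Rightarrow> 'a rel) set" where
  "MTORD F = {R \<in> TORD F. TM F R}"

definition JTORD :: "('a, 'm, 'c, 'n) fctr \<Rightarrow> ('c \<Rightarrow> 'a rel) set" where
  "JTORD F = {R \<in> TORD F. TJ F R}"

text \<open>The full subcategory of \<open>TORD(F)\<close> on a collection of topogenous orders.\<close>

definition TORD_cat ::
  "('a, 'm, 'c, 'n) fctr \<Rightarrow> ('c \<Rightarrow> 'a rel) set \<Rightarrow> ('c \<Rightarrow> 'a rel, ('c \<Rightarrow> 'a rel) \<times> ('c \<Rightarrow> 'a rel)) cat"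
  where "TORD_cat F \<K> = order_category (TORD_order F\<lparr>carrier := \<K>\<rparr>)"

end

theory Submission
  imports Defs
begin

text \<open>
  The conditions (T1)-(T3), (TM) and (TJ) are implications with at most one
  statement \<open>(A, B) \<in> R X\<close> as conclusion, so they pass to nonempty intersections.  The empty intersection is
  the family of fibre orders, and that it belongs to all the collections is where
  the form enters: (T1) and (T2) hold because each fibre is ordered, (T3) because pushing forward
  is left adjoint to pulling back (\<open>push_le_iff_le_pull\<close>), and (TM), (TJ) are then the
  universal properties of meets and joins.

  In particular the fibre orders form the largest topogenous order, so \<open>TORD_Inter\<close>
  is the infimum in the order of all topogenous orders, also for the empty collection.
  A subcollection closed under infima contains a least member above a given topogenous order,
  namely the infimum of all its members above it (\<open>least_above_if_Inter_closed\<close>); and in an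
  ordered set regarded as a category, such least members are reflections
  (\<open>reflective_order_subcategory\<close>).
\<close>

section \<open>Reflective subcategories of ordered sets\<close>

lemma category_order_category:
  assumes "\<And>x. x \<in> carrier L \<Longrightarrow> x \<sqsubseteq>\<^bsub>L\<^esub> x"
    and "\<And>x y z. \<lbrakk>x \<in> carrier L; y \<in> carrier L; z \<in> carrier L; x \<sqsubseteq>\<^bsub>L\<^esub> y; y \<sqsubseteq>\<^bsub>L\<^esub> z\<rbrakk> \<Longrightarrow> x \<sqsubseteq>\<^bsub>L\<^esub> z"
  shows "category (order_category L)"
  using assms unfolding category_def order_category_def Hom_def by auto

text \<open>The least element above \<open>x\<close> is a reflection of \<open>x\<close>; uniqueness of the factorisation is
  automatic, since hom-sets have at most one element.\<close>

lemma reflective_order_subcategory: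
  fixes L :: "('a, 'b) gorder_scheme"
  assumes refl: "\<And>x. x \<in> carrier L \<Longrightarrow> x \<sqsubseteq>\<^bsub>L\<^esub> x"
    and trans: "\<And>x y z. \<lbrakk>x \<in> carrier L; y \<in> carrier L; z \<in> carrier L; x \<sqsubseteq>\<^bsub>L\<^esub> y; y \<sqsubseteq>\<^bsub>L\<^esub> z\<rbrakk>
      \<Longrightarrow> x \<sqsubseteq>\<^bsub>L\<^esub> z"
    and K: "K \<subseteq> carrier L"
    and least: "\<And>x. x \<in> carrier L \<Longrightarrow> \<exists>a. least L a {y \<in> K. x \<sqsubseteq>\<^bsub>L\<^esub> y}"
  shows "reflective_subcategory (order_category (L\<lparr>carrier := K\<rparr>)) (order_category L)"
  unfolding reflective_subcategory_def
proof (intro conjI ballI)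
  have "category (order_category L)"
    by (rule category_order_category) (fact refl trans)+
  moreover have "category (order_category (L\<lparr>carrier := K\<rparr>))"
    using K by (intro category_order_category) (auto intro: refl trans)
  ultimately show "subcategory (order_category (L\<lparr>carrier := K\<rparr>)) (order_category L)"
    using K by (auto simp: subcategory_def order_category_def Hom_def)
next
  fix x assume "x \<in> Ob (order_category L)"
  then have x: "x \<in> carrier L" by (simp add: order_category_def)
  obtain a where a: "least L a {y \<in> K. x \<sqsubseteq>\<^bsub>L\<^esub> y}" using least[OF x] ..
  then have "a \<in> K" "x \<sqsubseteq>\<^bsub>L\<^esub> a" and le: "\<And>y. y \<in> K \<Longrightarrow> x \<sqsubseteq>\<^bsub>L\<^esub> y \<Longrightarrow> a \<sqsubseteq>\<^bsub>L\<^esub> y"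
    by (auto simp: least_def)
  with x K show "\<exists>a\<in>Ob (order_category (L\<lparr>carrier := K\<rparr>)). \<exists>r\<in>Hom (order_category L) x a.
      \<forall>b\<in>Ob (order_category (L\<lparr>carrier := K\<rparr>)). \<forall>f\<in>Hom (order_category L) x b.
        \<exists>!g. g \<in> Hom (order_category (L\<lparr>carrier := K\<rparr>)) a b \<and> Comp (order_category L) g r = f"
    by (intro bexI[of _ a] bexI[of _ "(x, a)"]) (auto simp: order_category_def Hom_def)
qed

section \<open>Pushing forward and pulling back\<close>

lemma is_push_push:
  assumes "form F" "has_liftings F" "f \<in> Ar (Tgt F)" "A \<in> fibre F (Dom (Tgt F) f)"
  shows "is_push F f A (push F f A)"
proof -
  have "\<exists>!D. is_push F f A D"
    using assms push_unique[OF assms(1,3)] by (auto simp: has_liftings_def)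
  then show ?thesis unfolding push_def by (rule theI')
qed

lemma is_pull_pull:
  assumes "form F" "has_liftings F" "f \<in> Ar (Tgt F)" "B \<in> fibre F (Cod (Tgt F) f)"
  shows "is_pull F f B (pull F f B)"
proof -
  have "\<exists>!D. is_pull F f B D"
    using assms pull_unique[OF assms(1,3)] by (auto simp: has_liftings_def)
  then show ?thesis unfolding pull_def by (rule theI')
qed

text \<open>Both sides say that \<open>A \<le>\<^sub>f B\<close>: take identities for \<open>g\<close> in the universal properties of
  the two liftings.\<close>

lemma push_le_iff_le_pull:
  assumes F: "form F" "has_liftings F" and f: "f \<in> Ar (Tgt F)"
    and A: "A \<in> fibre F (Dom (Tgt F) f)" and B: "B \<in> fibre F (Cod (Tgt F) f)"
  shows "push F f A \<sqsubseteq>\<^bsub>fibre_order F (Cod (Tgt F) f)\<^esub> B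
    \<longleftrightarrow> A \<sqsubseteq>\<^bsub>fibre_order F (Dom (Tgt F) f)\<^esub> pull F f B"
proof -
  have "category (Tgt F)" using F by (simp add: form_def is_functor_def)
  note c = categoryD[OF this]
  have f': "f \<in> Hom (Tgt F) (Dom (Tgt F) f) (Cod (Tgt F) f)" using f by (simp add: Hom_def)
  have "push F f A \<sqsubseteq>\<^bsub>fibre_order F (Cod (Tgt F) f)\<^esub> B \<longleftrightarrow> le_over F f A B"
    using is_push_push[OF F f A] B c(3)[OF c(2)[OF f]] c(6)[OF f']
    by (auto simp: is_push_def fibre_def fibre_order_def)
  also have "\<dots> \<longleftrightarrow> A \<sqsubseteq>\<^bsub>fibre_order F (Dom (Tgt F) f)\<^esub> pull F f B"
    using is_pull_pull[OF F f B] A c(3)[OF c(1)[OF f]] c(5)[OF f']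
    by (auto simp: is_pull_def fibre_def fibre_order_def)
  finally show ?thesis .
qed

section \<open>Intersections of topogenous orders\<close>

lemma TORD_top_in_TORD:
  assumes F: "form F" "has_liftings F"
  shows "TORD_top F \<in> TORD F"
  unfolding TORD_def
proof (intro CollectI conjI allI ballI impI)
  fix X A' A B B'
  assume X: "X \<in> Ob (Tgt F)"
    and fib: "A' \<in> fibre F X" "A \<in> fibre F X" "B \<in> fibre F X" "B' \<in> fibre F X"
    and le: "A' \<sqsubseteq>\<^bsub>fibre_order F X\<^esub> A" "(A, B) \<in> TORD_top F X" "B \<sqsubseteq>\<^bsub>fibre_order F X\<^esub> B'"
  interpret partial_order "fibre_order F X" by (rule partial_order_fibre_order[OF F(1) X])
  have car: "carrier (fibre_order F X) = fibre F X" by (simp add: fibre_order_def)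
  have "A' \<sqsubseteq>\<^bsub>fibre_order F X\<^esub> B"
    by (rule le_trans[of A' A B]) (use fib le car in \<open>auto simp: TORD_top_def\<close>)
  then have "A' \<sqsubseteq>\<^bsub>fibre_order F X\<^esub> B'"
    by (rule le_trans[of A' B B']) (use fib le car in auto)
  with fib show "(A', B') \<in> TORD_top F X" by (simp add: TORD_top_def)
next
  fix f A B
  assume f: "f \<in> Ar (Tgt F)" and A: "A \<in> fibre F (Dom (Tgt F) f)"
    and B: "B \<in> fibre F (Cod (Tgt F) f)"
    and "(push F f A, B) \<in> TORD_top F (Cod (Tgt F) f)"
  moreover have "pull F f B \<in> fibre F (Dom (Tgt F) f)"
    using is_pull_pull[OF F f B] by (simp add: is_pull_def)
  ultimately show "(A, pull F f B) \<in> TORD_top F (Dom (Tgt F) f)"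
    using push_le_iff_le_pull[OF F f A B] by (simp add: TORD_top_def)
qed (auto simp: TORD_top_def)

lemma TORD_Inter_in_TORD:
  assumes F: "form F" "has_liftings F" and K: "\<K> \<subseteq> TORD F"
  shows "TORD_Inter F \<K> \<in> TORD F"
proof (cases "\<K> = {}")
  case True
  with TORD_top_in_TORD[OF F] show ?thesis by (simp add: TORD_Inter_def)
next
  case False
  have R: "\<And>R X. R \<in> \<K> \<Longrightarrow> R X \<subseteq> fibre F X \<times> fibre F X"
    "\<And>R X A B. \<lbrakk>R \<in> \<K>; X \<in> Ob (Tgt F); (A, B) \<in> R X\<rbrakk> \<Longrightarrow> A \<sqsubseteq>\<^bsub>fibre_order F X\<^esub> B"
    "\<And>R X A' A B B'. \<lbrakk>R \<in> \<K>; X \<in> Ob (Tgt F); A' \<in> fibre F X; A \<in> fibre F X; B \<in> fibre F X;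
       B' \<in> fibre F X; A' \<sqsubseteq>\<^bsub>fibre_order F X\<^esub> A; (A, B) \<in> R X; B \<sqsubseteq>\<^bsub>fibre_order F X\<^esub> B'\<rbrakk>
       \<Longrightarrow> (A', B') \<in> R X"
    "\<And>R f A B. \<lbrakk>R \<in> \<K>; f \<in> Ar (Tgt F); A \<in> fibre F (Dom (Tgt F) f);
       B \<in> fibre F (Cod (Tgt F) f); (push F f A, B) \<in> R (Cod (Tgt F) f)\<rbrakk>
       \<Longrightarrow> (A, pull F f B) \<in> R (Dom (Tgt F) f)"
    using K unfolding TORD_def by blast+
  obtain R0 where "R0 \<in> \<K>" using False by blast
  then have "(\<lambda>X. \<Inter>R\<in>\<K>. R X) \<in> TORD F"
    unfolding TORD_def by (intro CollectI conjI allI ballI impI INT_I) (blast intro: R dest: R(1) R(2))+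
  with False show ?thesis by (simp add: TORD_Inter_def)
qed

lemma TORD_Inter_lower:
  assumes "R \<in> \<K>"
  shows "TORD_Inter F \<K> \<sqsubseteq>\<^bsub>TORD_order F\<^esub> R"
  using assms by (auto simp: TORD_Inter_def TORD_order_def)

lemma TORD_Inter_greatest:
  assumes "R \<in> TORD F" and "\<And>S. S \<in> \<K> \<Longrightarrow> R \<sqsubseteq>\<^bsub>TORD_order F\<^esub> S"
  shows "R \<sqsubseteq>\<^bsub>TORD_order F\<^esub> TORD_Inter F \<K>"
proof (cases "\<K> = {}")
  case True
  \<comment> \<open>by (T1), every topogenous order is contained in the family of fibre orders\<close>
  have "R X \<subseteq> TORD_top F X" if "X \<in> Ob (Tgt F)" for X
    using assms(1) that unfolding TORD_def TORD_top_def by blast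
  with True show ?thesis by (simp add: TORD_Inter_def TORD_order_def)
next
  case False
  with assms(2) show ?thesis by (fastforce simp: TORD_Inter_def TORD_order_def)
qed

lemma least_above_if_Inter_closed:
  assumes "K \<subseteq> TORD F" and closed: "\<And>\<K>. \<K> \<subseteq> K \<Longrightarrow> TORD_Inter F \<K> \<in> K" and "R \<in> TORD F"
  shows "least (TORD_order F) (TORD_Inter F {T \<in> K. R \<sqsubseteq>\<^bsub>TORD_order F\<^esub> T})
    {T \<in> K. R \<sqsubseteq>\<^bsub>TORD_order F\<^esub> T}"
proof -
  have "carrier (TORD_order F) = TORD F" by (simp add: TORD_order_def)
  with assms(1,3) show ?thesis
    by (auto simp: least_def intro!: closed TORD_Inter_lower TORD_Inter_greatest)
qed

lemma reflective_if_Inter_closed: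
  assumes "K \<subseteq> TORD F" and "\<And>\<K>. \<K> \<subseteq> K \<Longrightarrow> TORD_Inter F \<K> \<in> K"
  shows "reflective_subcategory (TORD_cat F K) (TORD_cat F (TORD F))"
proof -
  have "reflective_subcategory (order_category (TORD_order F\<lparr>carrier := K\<rparr>))
    (order_category (TORD_order F))"
  proof (rule reflective_order_subcategory)
    show "\<exists>S. least (TORD_order F) S {T \<in> K. R \<sqsubseteq>\<^bsub>TORD_order F\<^esub> T}"
      if "R \<in> carrier (TORD_order F)" for R
      using least_above_if_Inter_closed[OF assms] that by (auto simp: TORD_order_def)
  qed (use assms(1) in \<open>auto simp: TORD_order_def\<close>)
  then show ?thesis by (simp add: TORD_cat_def TORD_order_def)
qed

section \<open>Orders compatible with meets or with joins\<close>

text \<open>When \<open>\<K>\<close> is empty, (TM) says that every lower bound lies below the meet.\<close>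

lemma TM_TORD_Inter:
  assumes "\<And>R. R \<in> \<K> \<Longrightarrow> TM F R"
  shows "TM F (TORD_Inter F \<K>)"
  unfolding TM_def
proof (intro ballI allI impI)
  fix X A \<B> M
  assume *: "X \<in> Ob (Tgt F)" "A \<in> fibre F X" "\<B> \<subseteq> fibre F X"
    "is_glb (fibre_order F X) M \<B>" "\<forall>B\<in>\<B>. (A, B) \<in> TORD_Inter F \<K> X"
  show "(A, M) \<in> TORD_Inter F \<K> X"
  proof (cases "\<K> = {}")
    case True
    have "A \<in> Lower (fibre_order F X) \<B>"
      using * True by (auto simp: TORD_Inter_def TORD_top_def Lower_def fibre_order_def)
    moreover have "M \<in> fibre F X"
      using *(4) by (auto simp: greatest_def Lower_def fibre_order_def)
    ultimately show ?thesis
      using *(2,4) True by (auto simp: greatest_def TORD_Inter_def TORD_top_def)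
  next
    case False
    have "(A, M) \<in> R X" if "R \<in> \<K>" for R
      using assms[OF that, unfolded TM_def, rule_format, OF *(1-4)] *(5) that False
      by (auto simp: TORD_Inter_def)
    with False show ?thesis by (simp add: TORD_Inter_def)
  qed
qed

lemma TJ_TORD_Inter:
  assumes "\<And>R. R \<in> \<K> \<Longrightarrow> TJ F R"
  shows "TJ F (TORD_Inter F \<K>)"
  unfolding TJ_def
proof (intro ballI allI impI)
  fix X B \<A> J
  assume *: "X \<in> Ob (Tgt F)" "B \<in> fibre F X" "\<A> \<subseteq> fibre F X"
    "is_lub (fibre_order F X) J \<A>" "\<forall>A\<in>\<A>. (A, B) \<in> TORD_Inter F \<K> X"
  show "(J, B) \<in> TORD_Inter F \<K> X"
  proof (cases "\<K> = {}")
    case True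
    have "B \<in> Upper (fibre_order F X) \<A>"
      using * True by (auto simp: TORD_Inter_def TORD_top_def Upper_def fibre_order_def)
    moreover have "J \<in> fibre F X"
      using *(4) by (auto simp: least_def Upper_def fibre_order_def)
    ultimately show ?thesis
      using *(2,4) True by (auto simp: least_def TORD_Inter_def TORD_top_def)
  next
    case False
    have "(J, B) \<in> R X" if "R \<in> \<K>" for R
      using assms[OF that, unfolded TJ_def, rule_format, OF *(1-4)] *(5) that False
      by (auto simp: TORD_Inter_def)
    with False show ?thesis by (simp add: TORD_Inter_def)
  qed
qed

theorem mainTheorem3:
  fixes F :: "('a, 'm, 'c, 'n) fctr"
  assumes "form F" and "has_liftings F"
  shows "(\<forall>\<K>. \<K> \<subseteq> MTORD F \<longrightarrow> TORD_Inter F \<K> \<in> MTORD F)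
    \<and> (\<forall>\<K>. \<K> \<subseteq> JTORD F \<longrightarrow> TORD_Inter F \<K> \<in> JTORD F)
    \<and> reflective_subcategory (TORD_cat F (MTORD F)) (TORD_cat F (TORD F))
    \<and> reflective_subcategory (TORD_cat F (JTORD F)) (TORD_cat F (TORD F))
    \<and> (\<forall>R\<in>TORD F. \<exists>S. least (TORD_order F) S {T \<in> MTORD F. R \<sqsubseteq>\<^bsub>TORD_order F\<^esub> T})
    \<and> (\<forall>R\<in>TORD F. \<exists>S. least (TORD_order F) S {T \<in> JTORD F. R \<sqsubseteq>\<^bsub>TORD_order F\<^esub> T})"
proof -
  have sub: "MTORD F \<subseteq> TORD F" "JTORD F \<subseteq> TORD F" by (auto simp: MTORD_def JTORD_def)
  have M: "TORD_Inter F \<K> \<in> MTORD F" if "\<K> \<subseteq> MTORD F" for \<K>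
    using that TORD_Inter_in_TORD[OF assms, of \<K>] TM_TORD_Inter[of \<K> F] by (auto simp: MTORD_def)
  have J: "TORD_Inter F \<K> \<in> JTORD F" if "\<K> \<subseteq> JTORD F" for \<K>
    using that TORD_Inter_in_TORD[OF assms, of \<K>] TJ_TORD_Inter[of \<K> F] by (auto simp: JTORD_def)
  show ?thesis
    using M J reflective_if_Inter_closed[OF sub(1) M] reflective_if_Inter_closed[OF sub(2) J]
      least_above_if_Inter_closed[OF sub(1) M] least_above_if_Inter_closed[OF sub(2) J]
    by (intro conjI allI impI ballI exI)
qed

end
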